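(* The set $\ell^{\infty}\setminus c_0$ is maximal dense-lineable in $\ell^\infty$; that is, $(\ell^{\infty}\setminus c_0)\cup\{0\}$ contains a linear subspace of $\ell^\infty$ which is dense in $\ell^\infty$ and whose (algebraic) dimension equals $\dim(\ell^{\infty})$.
   Context: $\ell^{\infty}$ is the real Banach space of bounded real sequences (indexed by $\mathbb{N}$) with the uniform norm, and $c_0$ is its subspace of sequences converging to zero. A subset $M$ of a topological vector space $X$ is called maximal dense-lineable if $M\cup\{0\}$ contains a dense linear subspace of $X$ of dimension $\dim(X)$, where $\dim$ denotes algebraic (Hamel) dimension. *)

theory Defs
  imports "HOL-Analysis.Analysis"
begin

unbundle cardinal_syntax

text \<open>
  The topology on \<^typ>\<open>nat\<close> is discrete, so every bounded sequence is a bounded continuous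
  function and the type below is the whole space of bounded real sequences.
\<close>

type_synonym linfty = "nat \<Rightarrow>\<^sub>C real"

lemma linfty_carrier: "range (apply_bcontfun :: linfty \<Rightarrow> nat \<Rightarrow> real) = {x. bounded (range x)}"
proof -
  have "range (apply_bcontfun :: linfty \<Rightarrow> nat \<Rightarrow> real) = bcontfun"
    using type_definition.Rep_range[OF type_definition_bcontfun] .
  then show ?thesis by (auto simp: bcontfun_def)
qed

lemma norm_linfty: "norm (x :: linfty) = (SUP n. \<bar>apply_bcontfun x n\<bar>)"
  by (simp add: norm_bcontfun_def dist_bcontfun.rep_eq dist_real_def)

definition c0 :: "linfty set" where
  "c0 = {x. (\<lambda>n. apply_bcontfun x n) \<longlonglongrightarrow> 0}"

text \<open>
  The library's \<^const>\<open>dim\<close> is a natural number (\<open>0\<close> for infinite-dimensional spaces); here the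
  Hamel dimension is a cardinal, to be compared with \<open>=o\<close>. By the lemma that follows it does not
  depend on the basis chosen.
\<close>

definition hamel_dim :: "'a::real_vector set \<Rightarrow> 'a rel" where
  "hamel_dim V = |SOME B. independent B \<and> span B = span V|"

lemma hamel_dim_unique:
  assumes "independent B" "span B = span V"
  shows "hamel_dim V =o |B|"
proof -
  let ?C = "SOME B. independent B \<and> span B = span V"
  have C: "independent ?C \<and> span ?C = span V"
    by (rule someI[of _ B]) (use assms in blast)
  then have "\<exists>f. bij_betw f ?C B"
    using real_vector.bij_if_span_eq_span_bases[of ?C B] assms by auto
  then show ?thesis
    unfolding hamel_dim_def by (simp add: card_of_ordIso)
qed

text \<open>
  There is no type class of topological vector spaces; compatibility of the topology with the
  linear structure is a property of the types at which this is used (for \<open>linfty\<close>, the class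
  \<^class>\<open>real_normed_vector\<close>).
\<close>

definition maximal_dense_lineable :: "'a::{real_vector, topological_space} set \<Rightarrow> bool" where
  "maximal_dense_lineable M \<longleftrightarrow>
     (\<exists>W. subspace W \<and> W \<subseteq> M \<union> {0} \<and> closure W = UNIV \<and> hamel_dim W =o hamel_dim (UNIV :: 'a set))"

end

theory Submission
  imports Defs
begin

section \<open>Dense algebraic complements of a subspace of a normed space\<close>

lemma subspace_closure:
  fixes W :: "'a::real_normed_vector set"
  assumes W: "subspace W"
  shows "subspace (closure W)"
proof (rule subspaceI)
  show "0 \<in> closure W"
    using subspace_0[OF W] closure_subset by blast
next
  fix x y assume "x \<in> closure W" "y \<in> closure W"
  then obtain f g where "\<forall>n. f n \<in> W" "f \<longlonglongrightarrow> x" "\<forall>n. g n \<in> W" "g \<longlonglongrightarrow> y"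
    unfolding closure_sequential by blast
  then show "x + y \<in> closure W"
    unfolding closure_sequential
    by (intro exI[of _ "\<lambda>n. f n + g n"]) (auto intro: tendsto_add subspace_add[OF W])
next
  fix c and x assume "x \<in> closure W"
  then obtain f where "\<forall>n. f n \<in> W" "f \<longlonglongrightarrow> x"
    unfolding closure_sequential by blast
  then show "c *\<^sub>R x \<in> closure W"
    unfolding closure_sequential
    by (intro exI[of _ "\<lambda>n. c *\<^sub>R f n"]) (auto intro: tendsto_intros subspace_scale[OF W])
qed

text \<open>Extend \<open>A\<close> to a basis of \<open>span Y\<close>; two bases of the same span
  are equipotent, also when they are infinite.\<close>

lemma card_of_independent_ordLeq:
  fixes A Y :: "'a::real_vector set"
  assumes "independent A" "A \<subseteq> span Y" "independent Y"
  shows "|A| \<le>o |Y|"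
proof -
  obtain G where G: "A \<subseteq> G" "G \<subseteq> span Y" "independent G" "span Y \<subseteq> span G"
    using maximal_independent_subset_extend[OF assms(2,1)] by blast
  have "span G = span Y"
    using G by (simp add: span_minimal subset_antisym)
  then obtain f where "bij_betw f G Y"
    using real_vector.bij_if_span_eq_span_bases[OF G(3) assms(3)] by auto
  then have "|G| =o |Y|"
    using card_of_ordIso by blast
  with card_of_mono1[OF G(1)] show ?thesis
    by (rule ordLeq_ordIso_trans)
qed

text \<open>
  Let \<open>Y\<close> span an algebraic complement of \<open>C\<close>. The map \<open>\<Phi>\<close> embeds the whole space into the
  quotient by \<open>C\<close>, so \<open>Y\<close> is as large as a basis of the space. Adding an element of \<open>C\<close> to
  each vector of \<open>Y\<close> again spans a complement of \<open>C\<close>. Countably many such perturbations, by ever larger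
  multiples of the \<open>e k\<close>, put each \<open>e k\<close> and hence \<open>C\<close> into the closure of the new complement,
  which is therefore dense. For \<open>\<ell>\<^sup>\<infinity>\<close> and \<open>c0\<close>, \<open>\<Phi>\<close> repeats every coordinate infinitely often.
\<close>

theorem maximal_dense_lineable_compl_subspace:
  fixes C :: "'a::real_normed_vector set" and \<Phi> :: "'a \<Rightarrow> 'a" and e :: "nat \<Rightarrow> 'a"
  assumes C: "subspace C"
    and \<Phi>: "linear \<Phi>" "\<And>x. \<Phi> x \<in> C \<Longrightarrow> x = 0"
    and e: "range e \<subseteq> C" "C \<subseteq> closure (span (range e))"
    and inf: "independent (I :: 'a set)" "infinite I"
  shows "maximal_dense_lineable (UNIV - C)"
proof -
  obtain K where K: "K \<subseteq> C" "independent K" "C \<subseteq> span K"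
    using maximal_independent_subset by blast
  have spanK: "span K = C"
    using K C by (simp add: span_minimal subset_antisym)
  obtain D where D: "K \<subseteq> D" "independent D" "UNIV \<subseteq> span D"
    using maximal_independent_subset_extend[OF subset_UNIV K(2)] by metis
  define Y where "Y = D - K"
  have Y: "independent Y" "Y \<subseteq> D"
    using independent_mono[OF D(2)] by (auto simp: Y_def)
  \<comment> \<open>Locally shadows function extensionality: two linear maps are equal once they
    agree on the basis \<open>D\<close>.\<close>
  have ext: "f = g" if "linear f" "linear g" "\<And>d. d \<in> D \<Longrightarrow> f d = g d" for f g :: "'a \<Rightarrow> 'a"
    using linear_eq_on_span[OF that] D(3) by blast
  \<comment> \<open>The projection onto \<open>span Y\<close> along \<open>C\<close>; through it
    \<open>span Y\<close> serves as a model of the quotient by \<open>C\<close>.\<close>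
  define P :: "'a \<Rightarrow> 'a" where "P = construct D (\<lambda>d. if d \<in> Y then d else 0)"
  have P: "linear P" and PY: "\<And>y. y \<in> Y \<Longrightarrow> P y = y" and PK: "\<And>k. k \<in> K \<Longrightarrow> P k = 0"
    using Y D unfolding P_def
    by (auto simp: linear_construct construct_basis Y_def subset_iff)
  have PC: "P x = 0" if "x \<in> C" for x
    using real_vector.linear_eq_0_on_span[OF P PK] that spanK by blast
  have P_span_Y: "P y = y" if "y \<in> span Y" for y
    using real_vector.linear_eq_on_span[OF P linear_id, of Y y] that PY by simp
  have decomp: "P x \<in> span Y \<and> x - P x \<in> C" for x
  proof -
    have "x \<in> span (K \<union> Y)"
      using D(1,3) by (auto simp: Y_def Un_absorb1)
    then obtain k y where "x = k + y" "k \<in> span K" "y \<in> span Y"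
      unfolding span_Un by blast
    then show ?thesis
      using PC P_span_Y spanK by (simp add: linear_add[OF P])
  qed
  have P0: "P x = 0 \<longleftrightarrow> x \<in> C" for x
    using decomp[of x] PC by auto

  \<comment> \<open>The kernel of \<open>P\<close> is \<open>C\<close>, which contains
    \<open>\<Phi> x\<close> only for \<open>x = 0\<close>. So the basis \<open>D\<close> is carried
    injectively to an independent subset of \<open>span Y\<close>.\<close>
  have "linear (P \<circ> \<Phi>)"
    using \<Phi>(1) P by (rule linear_compose)
  moreover have inj: "inj (P \<circ> \<Phi>)"
    using \<Phi>(2) P0 by (subst linear_inj_iff_eq_0[OF calculation]) auto
  ultimately have "independent ((P \<circ> \<Phi>) ` D)"
    using D(2) by (intro linear_independent_injective_image) (auto simp: inj_on_def)
  moreover have "(P \<circ> \<Phi>) ` D \<subseteq> span Y"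
    using decomp by auto
  ultimately have "|(P \<circ> \<Phi>) ` D| \<le>o |Y|"
    using Y(1) by (rule card_of_independent_ordLeq)
  moreover have "|D| =o |(P \<circ> \<Phi>) ` D|"
    using inj by (metis bij_betw_imageI card_of_ordIso inj_on_subset subset_UNIV)
  ultimately have D_le_Y: "|D| \<le>o |Y|"
    by (rule ordIso_ordLeq_trans[rotated])
  then have YD: "|Y| =o |D|"
    using card_of_mono1[OF Y(2)] by (simp add: ordIso_iff_ordLeq)
  \<comment> \<open>The infinite independent set \<open>I\<close> forces \<open>D\<close>, hence
    \<open>Y\<close>, to be infinite, so there is room for countably many perturbed vectors.\<close>
  have "|I| \<le>o |D|"
    using D by (intro card_of_independent_ordLeq inf) auto
  then have "infinite Y"
    using D_le_Y inf(2) card_of_ordLeq_infinite ordLeq_transitive by blast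
  then obtain g :: "nat \<Rightarrow> 'a" where g: "inj g" "range g \<subseteq> Y"
    using infinite_countable_subset by blast

  \<comment> \<open>Decoding indices as pairs assigns infinitely many vectors of \<open>Y\<close> to
    each \<open>e k\<close>. Dividing \<open>d + h d\<close> by the coefficient of
    \<open>e k\<close> leaves \<open>e k\<close> plus a vector of norm \<open>1 / Suc n\<close>.
    Vectors outside \<open>range g\<close> stay unperturbed.\<close>
  define h where "h d = (let m = inv g d; (k, n) = prod_decode m in
      if d \<in> range g then (real (Suc n) * norm d) *\<^sub>R e k else 0)" for d
  have h: "h (g (prod_encode (k, n))) = (real (Suc n) * norm (g (prod_encode (k, n)))) *\<^sub>R e k" for k n
    using g(1) by (simp add: h_def)
  have hC: "h d \<in> C" for d
    using e(1) subspace_0[OF C] subspace_scale[OF C]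
    by (auto simp: h_def Let_def split: prod.split)
  define S :: "'a \<Rightarrow> 'a" where "S = construct D (\<lambda>d. if d \<in> Y then d + h d else 0)"
  have S: "linear S" and SY: "\<And>y. y \<in> Y \<Longrightarrow> S y = y + h y" and SK: "\<And>k. k \<in> K \<Longrightarrow> S k = 0"
    using Y D unfolding S_def
    by (auto simp: linear_construct construct_basis Y_def subset_iff)
  \<comment> \<open>The perturbations lie in \<open>C\<close>, the kernel of \<open>P\<close>.
    Disjointness from \<open>C\<close>, density and injectivity on \<open>span Y\<close> below all
    rest on this identity.\<close>
  have "P \<circ> S = P"
  proof (rule ext)
    show "(P \<circ> S) d = P d" if "d \<in> D" for d
      using that by (cases "d \<in> K")
        (auto simp: SK PK linear_0[OF P] SY linear_add[OF P] PC hC Y_def)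
  qed (use S P linear_compose in blast)+
  then have PS: "P (S x) = P x" for x
    by (metis comp_apply)
  have SC: "S x = 0" if "x \<in> C" for x
    using real_vector.linear_eq_0_on_span[OF S SK] that spanK by blast
  define W where "W = S ` span Y"
  have W: "subspace W" "W = span (S ` Y)"
    by (simp_all add: W_def linear_span_image[OF S] linear_subspace_image[OF S])
  have "W \<subseteq> (UNIV - C) \<union> {0}"
  proof -
    \<comment> \<open>Here \<open>P x = P (S x) = 0\<close>, so \<open>x\<close> lies in
      \<open>C\<close>, where \<open>S\<close> vanishes.\<close>
    have "S x = 0" if "S x \<in> C" for x
      using that SC P0[of x] P0[of "S x"] by (simp add: PS)
    then show ?thesis
      unfolding W_def by blast
  qed
  moreover have "closure W = UNIV"
  proof -
    have cW: "subspace (closure W)"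
      using W(1) by (rule subspace_closure)
    have "e k \<in> closure W" for k
    proof -
      let ?b = "\<lambda>n. g (prod_encode (k, n))"
      have bY: "?b n \<in> Y" for n
        using g(2) by auto
      have nz: "?b n \<noteq> 0" for n
        using bY[of n] Y(1) dependent_zero by metis
      have "(1 / (real (Suc n) * norm (?b n))) *\<^sub>R S (?b n)
          = (1 / real (Suc n)) *\<^sub>R sgn (?b n) + e k" for n
        using nz[of n] by (simp add: SY[OF bY] h sgn_div_norm scaleR_add_right inverse_eq_divide del: of_nat_Suc)
      moreover have "(\<lambda>n. (1 / real (Suc n)) *\<^sub>R sgn (?b n) + e k) \<longlonglongrightarrow> 0 + e k"
      proof (intro tendsto_add tendsto_const)
        show "(\<lambda>n. (1 / real (Suc n)) *\<^sub>R sgn (?b n)) \<longlonglongrightarrow> 0"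
          using LIMSEQ_inverse_real_of_nat nz
          by (subst tendsto_norm_zero_iff[symmetric]) (simp add: norm_sgn divide_inverse)
      qed
      moreover have "(1 / (real (Suc n) * norm (?b n))) *\<^sub>R S (?b n) \<in> W" for n
        using bY[of n] W(1) span_base by (auto simp: W_def intro!: subspace_scale)
      ultimately show ?thesis
        unfolding closure_sequential
        by (intro exI[of _ "\<lambda>n. (1 / (real (Suc n) * norm (?b n))) *\<^sub>R S (?b n)"]) simp
    qed
    then have "span (range e) \<subseteq> closure W"
      using cW by (intro span_minimal) auto
    then have "C \<subseteq> closure W"
      using e(2) closure_minimal[OF _ closed_closure] by blast
    moreover have "S x \<in> closure W" for x
    proof -
      have "S x = S (P x)"
        using SC[of "x - P x"] decomp[of x] by (simp add: linear_diff[OF S])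
      then have "S x \<in> W"
        using decomp[of x] by (simp add: W_def)
      then show ?thesis
        using closure_subset by blast
    qed
    moreover have "S x - x \<in> C" for x
      by (simp flip: P0 add: linear_diff[OF P] PS)
    \<comment> \<open>Every \<open>x\<close> is the difference of \<open>S x\<close>, which is in
      \<open>W\<close>, and \<open>S x - x\<close>, which is in \<open>C\<close>; the closure of
      \<open>W\<close> is a subspace containing both.\<close>
    ultimately have "S x - (S x - x) \<in> closure W" for x
      using subspace_diff[OF cW] by blast
    then show ?thesis
      by auto
  qed
  moreover have "hamel_dim W =o hamel_dim (UNIV :: 'a set)"
  proof -
    \<comment> \<open>\<open>y = P y = P (S y) = P 0\<close>.\<close>
    have "y = 0" if "y \<in> span Y" "S y = 0" for y
      using that PS[of y] P_span_Y by (simp add: linear_0[OF P])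
    then have inj: "inj_on S (span Y)"
      using linear_injective_on_subspace_0[OF S subspace_span] by blast
    then have "independent (S ` Y)"
      by (rule linear_independent_injective_image[OF S Y(1)])
    then have "hamel_dim W =o |S ` Y|"
      by (rule hamel_dim_unique) (simp only: W(2) span_span)
    moreover have "|S ` Y| =o |Y|"
      using inj_on_subset[OF inj span_superset]
      by (meson bij_betw_imageI card_of_ordIsoI ordIso_symmetric)
    moreover have "hamel_dim (UNIV :: 'a set) =o |D|"
      using D by (intro hamel_dim_unique) auto
    ultimately show ?thesis
      using YD ordIso_transitive ordIso_symmetric by meson
  qed
  ultimately show ?thesis
    using W(1) unfolding maximal_dense_lineable_def by blast
qed

section \<open>Bounded sequences and null sequences\<close>

lemma linfty_Bcontfun: "bounded (range x) \<Longrightarrow> apply_bcontfun (Bcontfun x) = x" for x :: "nat \<Rightarrow> real"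
  by (simp add: Bcontfun_inverse bcontfun_def)

lemma subspace_c0: "subspace c0"
  by (auto simp: c0_def subspace_def plus_bcontfun.rep_eq scaleR_bcontfun.rep_eq zero_bcontfun.rep_eq
      intro: tendsto_add_zero tendsto_mult_right_zero)

text \<open>The pairing function splits the positions into infinitely many infinite blocks; the
  block of \<open>k\<close> consists of all \<open>prod_encode (k, n)\<close>.\<close>

definition repeat_coords :: "linfty \<Rightarrow> linfty" where
  "repeat_coords x = Bcontfun (\<lambda>n. apply_bcontfun x (fst (prod_decode n)))"

lemma apply_repeat_coords: "apply_bcontfun (repeat_coords x) n = apply_bcontfun x (fst (prod_decode n))"
proof -
  have "bounded (range (\<lambda>n. apply_bcontfun x (fst (prod_decode n))))"
    by (rule bounded_subset[OF bounded_apply_bcontfun[of x]]) auto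
  then show ?thesis
    by (simp add: repeat_coords_def linfty_Bcontfun)
qed

lemma linear_repeat_coords: "linear repeat_coords"
  by (rule linearI; rule bcontfun_eqI)
    (simp_all add: apply_repeat_coords)

text \<open>On the block of \<open>k\<close> the repeated sequence is constant, equal to the
  coordinate of \<open>x\<close> at \<open>k\<close>, so a zero limit forces that coordinate to
  vanish.\<close>

lemma repeat_coords_in_c0:
  assumes "repeat_coords x \<in> c0"
  shows "x = 0"
proof (rule bcontfun_eqI)
  fix k
  \<comment> \<open>\<open>prod_encode (k, n)\<close> is the triangular number of
    \<open>k + n\<close>, plus \<open>k\<close>, hence strictly increasing in
    \<open>n\<close>.\<close>
  have "strict_mono (\<lambda>n. prod_encode (k, n))"
    by (rule strict_monoI_Suc) (simp add: prod_encode_def)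
  moreover have "(\<lambda>n. apply_bcontfun (repeat_coords x) n) \<longlonglongrightarrow> 0"
    using assms by (simp add: c0_def)
  ultimately have "(\<lambda>n. apply_bcontfun x k) \<longlonglongrightarrow> 0"
    using LIMSEQ_subseq_LIMSEQ by (fastforce simp: apply_repeat_coords o_def)
  then show "apply_bcontfun x k = apply_bcontfun 0 k"
    by (simp add: LIMSEQ_const_iff)
qed

definition unit_seq :: "nat \<Rightarrow> linfty" where
  "unit_seq k = Bcontfun (indicator {k})"

lemma apply_unit_seq: "apply_bcontfun (unit_seq k) n = (if n = k then 1 else 0)"
proof -
  have "bounded (range (indicator {k} :: nat \<Rightarrow> real))"
    by (rule boundedI[of _ 1]) (auto simp: indicator_def)
  then show ?thesis
    by (simp add: unit_seq_def linfty_Bcontfun indicator_def)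
qed

lemma unit_seq_in_c0: "unit_seq k \<in> c0"
proof -
  have "eventually (\<lambda>n. apply_bcontfun (unit_seq k) n = 0) sequentially"
    using eventually_gt_at_top[of k] by eventually_elim (simp add: apply_unit_seq)
  then show ?thesis
    by (simp add: c0_def tendsto_eventually)
qed

lemma inj_unit_seq: "inj unit_seq"
  by (rule injI) (metis apply_unit_seq zero_neq_one)

text \<open>The coordinate functional at \<open>k\<close> kills every other unit sequence but not
  \<open>unit_seq k\<close>.\<close>

lemma independent_unit_seq: "independent (range unit_seq)"
proof
  assume "dependent (range unit_seq)"
  then obtain k where k: "unit_seq k \<in> span (range unit_seq - {unit_seq k})"
    unfolding dependent_def by blast
  have "linear (\<lambda>x :: linfty. apply_bcontfun x k)"
    by (rule linearI) simp_all
  then have "apply_bcontfun (unit_seq k) k = 0"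
    by (rule real_vector.linear_eq_0_on_span[OF _ _ k]) (auto simp: apply_unit_seq)
  then show False
    by (simp add: apply_unit_seq)
qed

lemma apply_sum_bcontfun: "apply_bcontfun (sum f A) n = (\<Sum>k\<in>A. apply_bcontfun (f k) n)"
  for f :: "'b \<Rightarrow> linfty"
  by (induction A rule: infinite_finite_induct) auto

text \<open>Truncations are finite combinations of unit sequences, and the truncation error is the
  supremum of the tail.\<close>

lemma c0_subset_closure_span: "c0 \<subseteq> closure (span (range unit_seq))"
proof
  fix x assume x: "x \<in> c0"
  show "x \<in> closure (span (range unit_seq))"
    unfolding closure_approachable
  proof (intro allI impI)
    fix r :: real assume "0 < r"
    \<comment> \<open>Strict bounds on the entries give only a weak bound on the supremum; halving
      \<open>r\<close> restores strictness.\<close>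
    then have "0 < r / 2"
      by simp
    moreover have "(\<lambda>n. apply_bcontfun x n) \<longlonglongrightarrow> 0"
      using x by (simp add: c0_def)
    ultimately obtain N where "\<forall>n\<ge>N. norm (apply_bcontfun x n - 0) < r / 2"
      using LIMSEQ_D by blast
    then have N: "\<bar>apply_bcontfun x n\<bar> < r / 2" if "n \<ge> N" for n
      using that by simp
    let ?y = "\<Sum>k<N. apply_bcontfun x k *\<^sub>R unit_seq k"
    have y: "apply_bcontfun ?y n = (if n < N then apply_bcontfun x n else 0)" for n
      by (simp add: apply_sum_bcontfun apply_unit_seq if_distrib cong: if_cong)
    have "dist ?y x \<le> r / 2"
      using N \<open>0 < r\<close> by (intro dist_bound) (auto simp: y dist_real_def not_less less_imp_le)
    then have "dist ?y x < r"
      using \<open>0 < r\<close> by simp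
    moreover have "?y \<in> span (range unit_seq)"
      by (intro span_sum span_scale span_base) auto
    ultimately show "\<exists>y\<in>span (range unit_seq). dist y x < r"
      by blast
  qed
qed

theorem theorem1p2:
  shows "maximal_dense_lineable (UNIV - c0 :: linfty set)"
proof (rule maximal_dense_lineable_compl_subspace)
  show "range unit_seq \<subseteq> c0"
    using unit_seq_in_c0 by blast
  show "infinite (range unit_seq)"
    using inj_unit_seq by (simp add: finite_image_iff)
qed (fact subspace_c0 linear_repeat_coords repeat_coords_in_c0 c0_subset_closure_span
    independent_unit_seq)+

end
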